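(* For all integers $r\ge1$ and $N\ge1$, $$(1-abcdq^{r+N-1})\langle W|\mathsf d^N|V^r\rangle=(1-q^{2r-1}abcd)\langle W|\mathsf d^{N-1}|V^{r-1}\rangle-bdq^r(1-q^{N-1})\langle W|\mathsf d^{N-2}|V^r\rangle+\big(R_r-bdq^{r+N-1}(a+c)\big)\langle W|\mathsf d^{N-1}|V^r\rangle,$$ where $R_r=\frac{q^{r-1}}{1-abcdq^{2r-2}}\big(q(b+d)-q^{r-1}(b+d)abcd+bd(a+c)(1-q^r)\big)$, and for $N=1$ the term with coefficient $(1-q^{N-1})=0$ is omitted.
   Context: Fix generic complex parameters $a,b,c,d,q$. For integers $n\ge0$ define $\mathcal{A}_n=\frac{(1-q^{n-1}abcd)(1-q^{n+1})(1-q^nab)(1-q^nac)(1-q^nad)(1-q^nbc)(1-q^nbd)(1-q^ncd)}{(1-q^{2n-1}abcd)(1-q^{2n}abcd)^2(1-q^{2n+1}abcd)}$, $d_n^\natural=\frac{q^{n-1}}{(1-q^{2n-2}abcd)(1-q^{2n}abcd)}\big[bd(a+c)+(b+d)q-abcd(b+d)q^{n-1}-\{bd(a+c)+abcd(b+d)\}q^n-bd(a+c)q^{n+1}+ab^2cd^2(a+c)q^{2n-1}+abcd(b+d)q^{2n}\big]$, $e_n^\natural=\frac{q^{n-1}}{(1-q^{2n-2}abcd)(1-q^{2n}abcd)}\big[ac(b+d)+(a+c)q-abcd(a+c)q^{n-1}-\{ac(b+d)+abcd(a+c)\}q^n-ac(b+d)q^{n+1}+a^2bc^2d(b+d)q^{2n-1}+abcd(a+c)q^{2n}\big]$,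 $d_n^\sharp=1$, $d_n^\flat=-\frac{q^nbd}{(1-q^nac)(1-q^nbd)}\mathcal{A}_n$, $e_n^\sharp=-q^nac$, $e_n^\flat=\frac{\mathcal{A}_n}{(1-q^nac)(1-q^nbd)}$. Let $\mathsf d$ be the infinite tridiagonal matrix indexed by $\{0,1,\dots\}$ with nonzero entries $\mathsf d_{n,n}=d_n^\natural$, $\mathsf d_{n,n+1}=d_n^\sharp$, $\mathsf d_{n+1,n}=d_n^\flat$ (and $\mathsf e$ similarly). Let $\langle W|=(1,0,0,\dots)$ and $|V^r\rangle$ the column vector with $1$ in position $r$ (positions indexed from $0$) and $0$ elsewhere, so $\langle W|M|V^r\rangle=M_{0,r}$. *)

theory Defs
  imports Complex_Main "HOL-Library.Groups_Big_Fun"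
begin

(* Infinite matrices indexed by {0,1,...}.  Sum_any is the sum over the support of
   the summand; for tridiagonal matrices and their powers all supports below are finite. *)
type_synonym inf_matrix = "nat \<Rightarrow> nat \<Rightarrow> complex"

definition imat_one :: inf_matrix where
  "imat_one = (\<lambda>i j. if i = j then 1 else 0)"

definition imat_mult :: "inf_matrix \<Rightarrow> inf_matrix \<Rightarrow> inf_matrix" where
  "imat_mult A B = (\<lambda>i j. Sum_any (\<lambda>k. A i k * B k j))"

primrec imat_pow :: "inf_matrix \<Rightarrow> nat \<Rightarrow> inf_matrix" where
  "imat_pow A 0 = imat_one"
| "imat_pow A (Suc n) = imat_mult (imat_pow A n) A"

definition bra_ket :: "(nat \<Rightarrow> complex) \<Rightarrow> inf_matrix \<Rightarrow> (nat \<Rightarrow> complex) \<Rightarrow> complex" where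
  "bra_ket w A v = Sum_any (\<lambda>i. Sum_any (\<lambda>j. w i * A i j * v j))"

definition bra_W :: "nat \<Rightarrow> complex" where
  "bra_W = (\<lambda>i. if i = 0 then 1 else 0)"

definition ket_V :: "nat \<Rightarrow> nat \<Rightarrow> complex" where
  "ket_V r = (\<lambda>j. if j = r then 1 else 0)"

lemma bra_ket_W_V: "bra_ket bra_W A (ket_V r) = A 0 r"
proof -
  have single: "Sum_any f = f k" if "\<And>j. j \<noteq> k \<Longrightarrow> f j = 0" for f :: "nat \<Rightarrow> complex" and k
    using that by (subst Sum_any.expand_superset[of "{k}"]) auto
  have "Sum_any (\<lambda>j. bra_W i * A i j * ket_V r j) = bra_W i * A i r" for i
    by (subst single[of r]) (auto simp: ket_V_def)
  then have "bra_ket bra_W A (ket_V r) = Sum_any (\<lambda>i. bra_W i * A i r)"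
    by (simp add: bra_ket_def)
  also have "\<dots> = A 0 r"
    by (subst single[of 0]) (auto simp: bra_W_def)
  finally show ?thesis .
qed

definition tridiagonal ::
    "(nat \<Rightarrow> complex) \<Rightarrow> (nat \<Rightarrow> complex) \<Rightarrow> (nat \<Rightarrow> complex) \<Rightarrow> inf_matrix" where
  "tridiagonal diag upper lower = (\<lambda>i j.
     if j = i then diag i
     else if j = i + 1 then upper i
     else if i = j + 1 then lower j
     else 0)"

definition calA ::
    "complex \<Rightarrow> complex \<Rightarrow> complex \<Rightarrow> complex \<Rightarrow> complex \<Rightarrow> nat \<Rightarrow> complex" where
  "calA a b c d q n =
     ((1 - q powi (int n - 1) * a*b*c*d) * (1 - q^(n+1)) *
      (1 - q^n * a*b) * (1 - q^n * a*c) * (1 - q^n * a*d) *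
      (1 - q^n * b*c) * (1 - q^n * b*d) * (1 - q^n * c*d)) /
     ((1 - q powi (2 * int n - 1) * a*b*c*d) * (1 - q^(2*n) * a*b*c*d)^2 *
      (1 - q^(2*n+1) * a*b*c*d))"

definition d_natural ::
    "complex \<Rightarrow> complex \<Rightarrow> complex \<Rightarrow> complex \<Rightarrow> complex \<Rightarrow> nat \<Rightarrow> complex" where
  "d_natural a b c d q n =
     q powi (int n - 1) /
       ((1 - q powi (2 * int n - 2) * a*b*c*d) * (1 - q^(2*n) * a*b*c*d)) *
     (b*d*(a+c) + (b+d)*q
      - a*b*c*d*(b+d) * q powi (int n - 1)
      - (b*d*(a+c) + a*b*c*d*(b+d)) * q^n
      - b*d*(a+c) * q^(n+1)
      + a*b^2*c*d^2*(a+c) * q powi (2 * int n - 1)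
      + a*b*c*d*(b+d) * q^(2*n))"

definition d_sharp :: "nat \<Rightarrow> complex" where
  "d_sharp n = 1"

definition d_flat ::
    "complex \<Rightarrow> complex \<Rightarrow> complex \<Rightarrow> complex \<Rightarrow> complex \<Rightarrow> nat \<Rightarrow> complex" where
  "d_flat a b c d q n =
     - (q^n * b*d / ((1 - q^n * a*c) * (1 - q^n * b*d))) * calA a b c d q n"

definition d_matrix ::
    "complex \<Rightarrow> complex \<Rightarrow> complex \<Rightarrow> complex \<Rightarrow> complex \<Rightarrow> inf_matrix" where
  "d_matrix a b c d q = tridiagonal (d_natural a b c d q) d_sharp (d_flat a b c d q)"

definition R_coeff ::
    "complex \<Rightarrow> complex \<Rightarrow> complex \<Rightarrow> complex \<Rightarrow> complex \<Rightarrow> nat \<Rightarrow> complex" where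
  "R_coeff a b c d q r =
     q powi (int r - 1) / (1 - a*b*c*d * q powi (2 * int r - 2)) *
     (q*(b+d) - q powi (int r - 1) * (b+d)*a*b*c*d + b*d*(a+c)*(1 - q^r))"

(* Genericity: every negative power of q and every denominator occurring in the entries
   of the matrix and in R_coeff makes sense.  The exponents of q next to abcd are
   2n-2, 2n-1, 2n, 2n+1 for n >= 0, that is, all integers k >= -2. *)
definition generic_params ::
    "complex \<Rightarrow> complex \<Rightarrow> complex \<Rightarrow> complex \<Rightarrow> complex \<Rightarrow> bool" where
  "generic_params a b c d q \<longleftrightarrow>
     q \<noteq> 0 \<and>
     (\<forall>k::int. k \<ge> -2 \<longrightarrow> q powi k * a*b*c*d \<noteq> 1) \<and>
     (\<forall>n::nat. q^n * a*c \<noteq> 1) \<and>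
     (\<forall>n::nat. q^n * b*d \<noteq> 1)"

end

theory Submission
  imports Defs
begin

text \<open>
  Let $t = abcd$, let $u_N$ be row $0$ of $\mathsf d^N$, and let $Q$, $R$ be the diagonal matrices with
  entries $q^r$, $R_r$. Let $L$ be the matrix with entries $1 - tq^{2r-1}$ at $(r-1,r)$, and set
  $J = (\mathsf d - L - R)Q^{-1}$. The claim is that
  $u_N J = tq^N u_{N+1} - bd(a+c)q^N u_N - bd(1-q^N) u_{N-1}$ for all $N$. For $N = 0$ this is read off
  from the entries, and the induction step is the $q$-commutation relation
  $\mathsf d J - q J \mathsf d = -(1-q)bd$, which has to be checked on five diagonals only.
\<close>

definition row_mult ::
    "(nat \<Rightarrow> complex) \<Rightarrow> (nat \<Rightarrow> complex) \<Rightarrow> (nat \<Rightarrow> complex) \<Rightarrow> (nat \<Rightarrow> complex) \<Rightarrow> nat \<Rightarrow> complex" where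
  "row_mult diag upper lower u r =
     (case r of 0 \<Rightarrow> 0 | Suc m \<Rightarrow> u m * upper m) + u r * diag r + u (Suc r) * lower r"

lemma imat_mult_tridiagonal:
  "imat_mult A (tridiagonal diag upper lower) i = row_mult diag upper lower (A i)"
proof
  fix r
  let ?f = "\<lambda>k. A i k * tridiagonal diag upper lower k r"
  have "imat_mult A (tridiagonal diag upper lower) i r = sum ?f {r-1..Suc r}"
    unfolding imat_mult_def
    by (rule Sum_any.expand_superset) (auto simp: tridiagonal_def split: if_splits)
  also have "\<dots> = row_mult diag upper lower (A i) r"
    by (cases r) (simp_all add: row_mult_def tridiagonal_def numeral_2_eq_2)
  finally show "imat_mult A (tridiagonal diag upper lower) i r = row_mult diag upper lower (A i) r" .
qed

lemma row_mult_q_commute: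
  assumes up: "\<And>m. up1 m * up2 (Suc m) = q * (up2 m * up1 (Suc m))"
    and lo: "\<And>m. lo1 (Suc m) * lo2 m = q * (lo2 (Suc m) * lo1 m)"
    and dg_up: "\<And>m. dg1 m * up2 m + up1 m * dg2 (Suc m) = q * (dg2 m * up1 m + up2 m * dg1 (Suc m))"
    and dg_lo: "\<And>m. lo1 m * dg2 m + dg1 (Suc m) * lo2 m = q * (lo2 m * dg1 m + dg2 (Suc m) * lo1 m)"
    and dg_0: "dg1 0 * dg2 0 + up1 0 * lo2 0 = q * (dg2 0 * dg1 0 + up2 0 * lo1 0) - k"
    and dg_Suc: "\<And>m. lo1 m * up2 m + dg1 (Suc m) * dg2 (Suc m) + up1 (Suc m) * lo2 (Suc m)
      = q * (lo2 m * up1 m + dg2 (Suc m) * dg1 (Suc m) + up2 (Suc m) * lo1 (Suc m)) - k"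
  shows "row_mult dg2 up2 lo2 (row_mult dg1 up1 lo1 u) r
    = q * row_mult dg1 up1 lo1 (row_mult dg2 up2 lo2 u) r - k * u r"
proof (cases r)
  case 0
  show ?thesis
    unfolding 0 using dg_0 dg_lo[of 0] lo[of 0] by (simp add: row_mult_def) algebra
next
  case r: (Suc m)
  show ?thesis
  proof (cases m)
    case 0
    show ?thesis
      unfolding r 0 using dg_Suc[of 0] dg_lo[of 1] lo[of 1] dg_up[of 0]
      by (simp add: row_mult_def) algebra
  next
    case (Suc l)
    show ?thesis
      unfolding r Suc
      using dg_Suc[of "Suc l"] dg_lo[of "Suc (Suc l)"] lo[of "Suc (Suc l)"] dg_up[of "Suc l"] up[of l]
      by (simp add: row_mult_def) algebra
  qed
qed

lemma row_mult_linear: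
  "row_mult dg up lo (\<lambda>r. \<alpha> * f r - \<beta> * g r - \<gamma> * h r) r
    = \<alpha> * row_mult dg up lo f r - \<beta> * row_mult dg up lo g r - \<gamma> * row_mult dg up lo h r"
  by (cases r) (simp_all add: row_mult_def algebra_simps)

text \<open>
  The diagonal entries of $\mathsf d$ and $J$ as functions of $y = q^{r-1}$, in terms of
  $w = bd(a+c)$, $s = b+d$ and $t = abcd$.
\<close>

definition d_entry :: "complex \<Rightarrow> complex \<Rightarrow> complex \<Rightarrow> complex \<Rightarrow> complex \<Rightarrow> complex" where
  "d_entry w s t q y =
     y * (w + s*q - t*s*y - (w + t*s)*q*y - w*q^2*y + t*w*q*y^2 + t*s*q^2*y^2)
     / ((1 - t*y^2) * (1 - t*q^2*y^2))"

definition J_entry :: "complex \<Rightarrow> complex \<Rightarrow> complex \<Rightarrow> complex \<Rightarrow> complex \<Rightarrow> complex" where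
  "J_entry w s t q y =
     y * (- t*s - w*q + t*w*y + t*s*q*y + t*s*q^2*y - t^2*s*q*y^2 + t*w*q*y - t*w*q^2*y^2)
     / ((1 - t*y^2) * (1 - t*q^2*y^2))"

lemma entry_upper_relation:
  assumes "t*y^2 \<noteq> 1" "t*q^2*y^2 \<noteq> 1" "t*q^4*y^2 \<noteq> 1"
  shows "d_entry w s t q y * (t*(q*y)) + J_entry w s t q (q*y)
    = q * (J_entry w s t q y + t*(q*y) * d_entry w s t q (q*y))"
proof -
  obtain P S T where P: "P = 1 - t*y^2" "S = 1 - t*q^2*y^2" "T = 1 - t*q^4*y^2"
    by blast
  have nz: "P \<noteq> 0" "S \<noteq> 0" "T \<noteq> 0"
    using assms P by auto
  have e: "1 - t*(q*y)^2 = S" "1 - t*q^2*(q*y)^2 = T"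
    by (simp_all add: P power_mult_distrib power2_eq_square power4_eq_xxxx)
  show ?thesis
    unfolding d_entry_def J_entry_def e P(1,2)[symmetric]
    by (simp add: divide_simps nz) (use P in algebra)
qed

lemma entry_lower_relation:
  assumes "t*y^2 \<noteq> 1" "t*q^2*y^2 \<noteq> 1" "t*q^4*y^2 \<noteq> 1"
  shows "q*y * J_entry w s t q y + d_entry w s t q (q*y)
    = q * (q*y * J_entry w s t q (q*y) + d_entry w s t q y)"
proof -
  obtain P S T where P: "P = 1 - t*y^2" "S = 1 - t*q^2*y^2" "T = 1 - t*q^4*y^2"
    by blast
  have nz: "P \<noteq> 0" "S \<noteq> 0" "T \<noteq> 0"
    using assms P by auto
  have e: "1 - t*(q*y)^2 = S" "1 - t*q^2*(q*y)^2 = T"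
    by (simp_all add: P power_mult_distrib power2_eq_square power4_eq_xxxx)
  show ?thesis
    unfolding d_entry_def J_entry_def e P(1,2)[symmetric]
    by (simp add: divide_simps nz) (use P in algebra)
qed

text \<open>
  The product $bd(1-xab)(1-xad)(1-xbc)(1-xcd)$, written with $p = bd$.
\<close>

definition G_poly :: "complex \<Rightarrow> complex \<Rightarrow> complex \<Rightarrow> complex \<Rightarrow> complex \<Rightarrow> complex" where
  "G_poly w s t p x =
     p - x*w*s + x^2*w^2 - 2*x^2*p*t + x^2*t*s^2 - x^3*t*w*s + x^4*p*t^2"

lemma G_poly_factor:
  "G_poly (b*d*(a+c)) (b+d) (a*b*c*d) (b*d) x
    = b*d * ((1 - x*a*b) * (1 - x*a*d) * (1 - x*b*c) * (1 - x*c*d))"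
  unfolding G_poly_def by algebra

lemma entry_diagonal_relation:
  assumes "t*y^2 \<noteq> 1" "t*q^2*y^2 \<noteq> 1" "t*q*y^2 \<noteq> 1"
  shows "(1 - q) * (d_entry w s t q y * J_entry w s t q y)
    - (1 - t*y) * (1 - q^2*y) * G_poly w s t p (q*y) / ((1 - t*q*y^2) * (1 - t*q^2*y^2)^2)
    + (q - t*y) * (1 - q*y) * G_poly w s t p y / ((1 - t*y^2)^2 * (1 - t*q*y^2))
    = - ((1 - q) * p)"
proof -
  obtain P S T A B G H where P: "P = 1 - t*y^2" "S = 1 - t*q^2*y^2" "T = 1 - t*q*y^2"
    and AB: "A = w + s*q - t*s*y - (w + t*s)*q*y - w*q^2*y + t*w*q*y^2 + t*s*q^2*y^2"
      "B = - t*s - w*q + t*w*y + t*s*q*y + t*s*q^2*y - t^2*s*q*y^2 + t*w*q*y - t*w*q^2*y^2"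
    and GH: "G = G_poly w s t p (q*y)" "H = G_poly w s t p y"
    by blast
  have nz: "P \<noteq> 0" "S \<noteq> 0" "T \<noteq> 0"
    using assms P by auto
  have "(1-q) * y^2 * A * B * T - (1-t*y)*(1-q^2*y)*G*P^2 + (q-t*y)*(1-q*y)*H*S^2
      + (1-q)*p*P^2*S^2*T = 0"
    unfolding P AB GH G_poly_def by algebra
  then show ?thesis
    unfolding d_entry_def J_entry_def P[symmetric] AB[symmetric] GH[symmetric]
    by (simp add: divide_simps nz) algebra
qed

locale generic_parameters =
  fixes a b c d q :: complex
  assumes generic: "generic_params a b c d q"
begin

abbreviation "t \<equiv> a*b*c*d"
abbreviation "w \<equiv> b*d*(a+c)"
abbreviation "y r \<equiv> q powi (int r - 1)"

definition J_diag :: "nat \<Rightarrow> complex" where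
  "J_diag r = (d_natural a b c d q r - R_coeff a b c d q r) / q^r"

abbreviation "J_upper r \<equiv> t * q^r"
abbreviation "J_lower r \<equiv> d_flat a b c d q r / q^r"

abbreviation "row_d \<equiv> row_mult (d_natural a b c d q) d_sharp (d_flat a b c d q)"
abbreviation "row_J \<equiv> row_mult J_diag J_upper J_lower"

abbreviation "u N \<equiv> imat_pow (d_matrix a b c d q) N 0"

lemma q_nonzero: "q \<noteq> 0"
  using generic by (simp add: generic_params_def)

lemma powers_in_y:
  shows "q ^ r = q * y r" "y (Suc r) = q * y r"
    and "q powi (2 * int r - 2) = y r ^ 2" "q powi (2 * int r - 1) = q * y r ^ 2"
    and "q ^ (2 * r) = q^2 * y r ^ 2"
proof -
  show 1: "q ^ r = q * y r"
    using q_nonzero by (simp add: power_int_diff)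
  then show "y (Suc r) = q * y r"
    by simp
  have sq: "y r ^ 2 = q powi (2 * int r - 2)"
    using power_int_add[of q "int r - 1" "int r - 1"] q_nonzero
    by (simp add: power2_eq_square algebra_simps)
  then show "q powi (2 * int r - 2) = y r ^ 2" ..
  show "q powi (2 * int r - 1) = q * y r ^ 2"
    unfolding sq using q_nonzero power_int_add[of q 1 "2 * int r - 2"] by (simp add: algebra_simps)
  show "q ^ (2 * r) = q^2 * y r ^ 2"
    using 1 by (simp add: power_mult mult.commute[of 2] power_mult_distrib)
qed

lemma denominator_nonzero: "t * q^k * y r ^ 2 \<noteq> 1"
proof -
  have "q^k * y r ^ 2 = q powi (int k + (2 * int r - 2))"
    using q_nonzero by (simp add: power_int_add powers_in_y(3)[symmetric])
  moreover have "q powi (int k + (2 * int r - 2)) * a*b*c*d \<noteq> 1"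
    using generic by (simp add: generic_params_def)
  ultimately show ?thesis
    by (simp add: ac_simps)
qed

lemmas denominators_nonzero =
  denominator_nonzero[of 0, simplified] denominator_nonzero[of 1, simplified]
  denominator_nonzero[of 2] denominator_nonzero[of 3] denominator_nonzero[of 4]

lemma d_natural_eq: "d_natural a b c d q r = d_entry w (b+d) t q (y r)"
  unfolding d_natural_def d_entry_def powers_in_y[of r] power_add power_one_right
    times_divide_eq_left
  by (rule arg_cong2[where f = "(/)"]; algebra)

lemma J_diag_eq: "J_diag r = J_entry w (b+d) t q (y r)"
proof -
  obtain P S where P: "P = 1 - t * y r ^ 2" "S = 1 - t * q^2 * y r ^ 2"
    by blast
  have nz: "P \<noteq> 0" "S \<noteq> 0" "y r \<noteq> 0"
    using denominators_nonzero[of r] q_nonzero P by auto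
  have "R_coeff a b c d q r
      = y r * (q*(b+d) - y r * (b+d)*t + w*(1 - q * y r)) / P"
    unfolding R_coeff_def powers_in_y[of r] P by (simp add: mult.assoc)
  then show ?thesis
    unfolding J_diag_def d_natural_eq d_entry_def J_entry_def P[symmetric] powers_in_y(1)[of r]
    by (simp add: divide_simps nz q_nonzero) (use P in algebra)
qed

lemma d_flat_eq:
  "d_flat a b c d q r = - (q * y r) * ((1 - t * y r) * (1 - q^2 * y r)
      * G_poly w (b+d) t (b*d) (q * y r))
      / ((1 - t * q * y r ^ 2) * (1 - t * q^2 * y r ^ 2)^2 * (1 - t * q^3 * y r ^ 2))"
proof -
  have nz: "1 - q^r * a*c \<noteq> 0" "1 - q^r * b*d \<noteq> 0"
    using generic by (simp_all add: generic_params_def)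
  have "d_flat a b c d q r = - (q^r) * ((1 - y r * a*b*c*d) * (1 - q^(r+1))
      * (b*d * ((1 - q^r*a*b) * (1 - q^r*a*d) * (1 - q^r*b*c) * (1 - q^r*c*d))))
      / ((1 - q powi (2 * int r - 1) * a*b*c*d) * (1 - q^(2*r) * a*b*c*d)^2 *
      (1 - q^(2*r+1) * a*b*c*d))"
    unfolding d_flat_def calA_def using nz by (simp add: divide_simps)
  then show ?thesis
    unfolding G_poly_factor powers_in_y[of r] power_add power_one_right
    by (simp add: power2_eq_square power3_eq_cube mult_ac)
qed

lemma d_flat_upper_combination:
  "d_flat a b c d q r / q^r - q * (t * q^r * d_flat a b c d q r)
    = - ((1 - t * y r) * (1 - q^2 * y r) * G_poly w (b+d) t (b*d) (q * y r)
      / ((1 - t * q * y r ^ 2) * (1 - t * q^2 * y r ^ 2)^2))"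
proof -
  obtain T S Z where T: "T = 1 - t * q * y r ^ 2" "S = 1 - t * q^2 * y r ^ 2" "Z = 1 - t * q^3 * y r ^ 2"
    by blast
  have nz: "T \<noteq> 0" "S \<noteq> 0" "Z \<noteq> 0" "y r \<noteq> 0"
    using denominators_nonzero[of r] q_nonzero T by auto
  show ?thesis
    unfolding d_flat_eq T[symmetric] powers_in_y(1)[of r]
    by (simp add: divide_simps nz q_nonzero) (use T(3) in algebra)
qed

lemma d_flat_lower_combination:
  fixes r defines "z \<equiv> y (Suc r)"
  shows "d_flat a b c d q r * (t * q^r) - q * (d_flat a b c d q r / q^r)
    = (q - t*z) * (1 - q*z) * G_poly w (b+d) t (b*d) z / ((1 - t*z^2)^2 * (1 - t*q*z^2))"
proof -
  obtain T S Z where T: "T = 1 - t * q * y r ^ 2" "S = 1 - t * q^2 * y r ^ 2" "Z = 1 - t * q^3 * y r ^ 2"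
    by blast
  have nz: "T \<noteq> 0" "S \<noteq> 0" "Z \<noteq> 0" "y r \<noteq> 0"
    using denominators_nonzero[of r] q_nonzero T by auto
  have z: "z = q * y r" "1 - t*z^2 = S" "1 - t*q*z^2 = Z"
    unfolding z_def powers_in_y(2) T by (simp_all add: power2_eq_square power3_eq_cube)
  show ?thesis
    unfolding d_flat_eq z(2,3) T[symmetric] powers_in_y(1)[of r] unfolding z(1)
    by (simp add: divide_simps nz q_nonzero) (use T(1) in algebra)
qed

lemma row_q_commute:
  "row_J (row_d v) r = q * row_d (row_J v) r - (1 - q) * (b*d) * v r"
proof (rule row_mult_q_commute)
  fix m
  note nz = denominators_nonzero[of m]
  have ym: "y m \<noteq> 0"
    using q_nonzero by simp
  show "d_sharp m * J_upper (Suc m) = q * (J_upper m * d_sharp (Suc m))"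
    by (simp add: d_sharp_def)
  show "d_flat a b c d q (Suc m) * J_lower m = q * (J_lower (Suc m) * d_flat a b c d q m)"
    using q_nonzero by simp
  show "d_natural a b c d q m * J_upper m + d_sharp m * J_diag (Suc m)
      = q * (J_diag m * d_sharp m + J_upper m * d_natural a b c d q (Suc m))"
    using entry_upper_relation[OF nz(1,3,5), of w "b+d"]
    unfolding J_diag_eq d_natural_eq powers_in_y(1)[of m] powers_in_y(2) by (simp add: d_sharp_def)
  have "d_flat a b c d q m / (q * y m) * (q * y m * J_diag m + d_natural a b c d q (Suc m))
      = d_flat a b c d q m / (q * y m) *
        (q * (q * y m * J_diag (Suc m) + d_natural a b c d q m))"
    using entry_lower_relation[OF nz(1,3,5), of w "b+d"]
    unfolding J_diag_eq d_natural_eq powers_in_y(2) by simp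
  then show "d_flat a b c d q m * J_diag m + d_natural a b c d q (Suc m) * J_lower m
      = q * (J_lower m * d_natural a b c d q m + J_diag (Suc m) * d_flat a b c d q m)"
    unfolding powers_in_y(1)[of m] J_diag_eq using ym q_nonzero by (simp add: field_simps)
  have "(1 - q) * (d_natural a b c d q (Suc m) * J_diag (Suc m))
      + (J_lower (Suc m) - q * (J_upper (Suc m) * d_flat a b c d q (Suc m)))
      + (d_flat a b c d q m * J_upper m - q * J_lower m) = - ((1 - q) * (b*d))"
    unfolding d_flat_upper_combination d_flat_lower_combination J_diag_eq d_natural_eq
    using entry_diagonal_relation[OF denominators_nonzero(1,3,2)[of "Suc m"], of w "b+d" "b*d"]
    by simp
  then show "d_flat a b c d q m * J_upper m + d_natural a b c d q (Suc m) * J_diag (Suc m)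
        + d_sharp (Suc m) * J_lower (Suc m)
      = q * (J_lower m * d_sharp m + J_diag (Suc m) * d_natural a b c d q (Suc m)
        + J_upper (Suc m) * d_flat a b c d q (Suc m)) - (1 - q) * (b*d)"
    by (simp add: d_sharp_def algebra_simps)
next
  have "1 - q * y 0 = 0"
    using q_nonzero by simp
  then have "(1 - q) * (d_natural a b c d q 0 * J_diag 0)
      + (J_lower 0 - q * (J_upper 0 * d_flat a b c d q 0)) = - ((1 - q) * (b*d))"
    unfolding d_flat_upper_combination J_diag_eq d_natural_eq
    using entry_diagonal_relation[OF denominators_nonzero(1,3,2)[of 0], of w "b+d" "b*d"]
    by (simp only:) simp
  then show "d_natural a b c d q 0 * J_diag 0 + d_sharp 0 * J_lower 0
      = q * (J_diag 0 * d_natural a b c d q 0 + J_upper 0 * d_flat a b c d q 0) - (1 - q) * (b*d)"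
    by (simp add: d_sharp_def algebra_simps)
qed

lemma u_Suc: "u (Suc N) = row_d (u N)"
  by (simp add: d_matrix_def imat_mult_tridiagonal)

lemma row_J_u_0: "row_J (u 0) r = t * u 1 r - w * u 0 r"
proof -
  have u1: "u 1 = row_d (u 0)"
    using u_Suc[of 0] by simp
  show ?thesis
  proof (cases r)
    case 0
    obtain P S x where P: "P = 1 - t * x^2" "S = 1 - t * q^2 * x^2" and x: "x = y 0"
      by blast
    have nz: "P \<noteq> 0" "S \<noteq> 0" and qx: "q * x = 1"
      using denominators_nonzero[of 0] q_nonzero by (auto simp: P x)
    have "J_entry w (b+d) t q x = t * d_entry w (b+d) t q x - w"
      unfolding J_entry_def d_entry_def P[symmetric]
      by (simp add: divide_simps nz) (use P qx in algebra)
    then show ?thesis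
      unfolding u1 0 by (simp add: row_mult_def imat_one_def J_diag_eq d_natural_eq x)
  next
    case (Suc m)
    then show ?thesis
      unfolding u1 by (cases m) (simp_all add: row_mult_def imat_one_def d_sharp_def)
  qed
qed

lemma row_J_u:
  "row_J (u N) r = t * q^N * u (Suc N) r - w * q^N * u N r - b*d * (1 - q^N) * u (N-1) r"
proof (induction N arbitrary: r)
  case 0
  then show ?case
    using row_J_u_0[of r] by simp
next
  case (Suc N)
  have "row_J (u (Suc N)) r = q * row_d (row_J (u N)) r - (1 - q) * (b*d) * u N r"
    unfolding u_Suc by (rule row_q_commute)
  also have "row_J (u N) = (\<lambda>r. (t * q^N) * u (Suc N) r - (w * q^N) * u N r
      - (b*d * (1 - q^N)) * u (N-1) r)"
    using Suc.IH by (simp add: mult.assoc fun_eq_iff)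
  also have "row_d \<dots> r = (t * q^N) * row_d (u (Suc N)) r - (w * q^N) * row_d (u N) r
      - (b*d * (1 - q^N)) * row_d (u (N-1)) r"
    by (rule row_mult_linear)
  also have "(b*d * (1 - q^N)) * row_d (u (N-1)) r = (b*d * (1 - q^N)) * u N r"
    by (cases N) (simp_all add: u_Suc del: imat_pow.simps)
  finally show ?case
    by (simp add: u_Suc algebra_simps del: imat_pow.simps)
qed

lemma row_J_eq:
  "q^r * row_J v r = row_d v r - R_coeff a b c d q r * v r
    - (case r of 0 \<Rightarrow> 0 | Suc m \<Rightarrow> (1 - q^(2*r-1) * t) * v m)"
  using q_nonzero
  by (cases r) (simp_all add: row_mult_def d_sharp_def J_diag_def field_simps mult_2_right power_add)

end

theorem theorem7p12:
  fixes a b c d q :: complex and r N :: nat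
  assumes "generic_params a b c d q"
    and "r \<ge> 1" and "N \<ge> 1"
  shows "(1 - a*b*c*d * q^(r+N-1)) * bra_ket bra_W (imat_pow (d_matrix a b c d q) N) (ket_V r) =
      (1 - q^(2*r-1) * a*b*c*d) *
        bra_ket bra_W (imat_pow (d_matrix a b c d q) (N-1)) (ket_V (r-1))
      - (if N = 1 then 0
         else b*d * q^r * (1 - q^(N-1)) *
           bra_ket bra_W (imat_pow (d_matrix a b c d q) (N-2)) (ket_V r))
      + (R_coeff a b c d q r - b*d * q^(r+N-1) * (a+c)) *
        bra_ket bra_W (imat_pow (d_matrix a b c d q) (N-1)) (ket_V r)"
proof -
  interpret generic_parameters a b c d q
    using assms(1) by unfold_locales
  obtain m M where r: "r = Suc m" and N: "N = Suc M"
    using assms(2,3) by (metis Suc_le_D One_nat_def)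
  have tail: "(if N = 1 then 0 else b*d * q^r * (1 - q^(N-1)) * u (N-2) r)
      = b*d * q^r * (1 - q^M) * u (M-1) r"
    by (auto simp: N numeral_2_eq_2)
  have rel: "u N r - R_coeff a b c d q r * u M r - (1 - q^(2*r-1) * t) * u M m
      = q^r * (t * q^M * u N r - w * q^M * u M r - b*d * (1 - q^M) * u (M-1) r)"
    using row_J_eq[of r "u M"] row_J_u[of M r] by (simp add: r N u_Suc del: imat_pow.simps)
  have pred: "q^(r+N-1) = q^r * q^M" "N - 1 = M" "r - 1 = m"
    by (simp_all add: r N power_add)
  show ?thesis
    unfolding bra_ket_W_V tail unfolding pred using rel by (simp add: algebra_simps)
qed

end
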